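(* Let $R = \mathbb{Z}_2[A,B,C,T]/\langle A^3 - C^6,\ B^3 - C^6,\ T^2 - A - B\rangle$, where $A, B, C, T$ are indeterminates, $A$ and $B$ being given degree $2$ and $C$ and $T$ degree $1$. Let $c$ and $t$ be the residue classes of $C$ and $T$ in $R$, respectively, and let $I = \langle c \rangle \subseteq R$. Then $t \in I^{\natural} \setminus I^{\boxed{\#}}$; in particular $I^{\boxed{\#}} \neq I^{\natural}$.
   Context: $\mathbb{Z}_2$ denotes the field with two elements. For an ideal $I$ of a commutative ring $R$ with identity, let $I^{\#}$ be the ideal of $R$ generated by $\{x \in R \mid x^n \in I^n \text{ for some } n \ge 1\}$; let $I^{\#_1} = I^{\#}$ and, for $\ell > 1$, $I^{\#_\ell} = \langle x \in R \mid x^n \in (I^{\#_{\ell-1}})^n \text{ for some } n \ge 1\rangle$; let $I^{\boxed{\#}} = \bigcup_{\ell \ge 1} I^{\#_\ell}$ (an increasing union of ideals); and let $I^{\natural} = \{x \in R \mid x^n \in (I^n)^{\boxed{\#}} \text{ for some } n \ge 1\}$, which is an ideal of $R$. *)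

theory Defs
  imports
    "HOL-Library.Poly_Mapping"
    "HOL-Library.Z2"
    "HOL-Algebra.Algebraic_Closure_Type"
    "HOL-Algebra.Ideal_Product"
    "HOL-Algebra.QuotRing"
begin

section \<open>Sharp and natural closures of an ideal\<close>

text \<open>
  The library makes the ideals of \<open>R\<close> into a monoid \<^const>\<open>ideals_set\<close> under the ideal product,
  with unit the whole ring, so the ideal power is the power of that monoid.
\<close>

abbreviation ideal_power :: "('a, 'b) ring_scheme \<Rightarrow> 'a set \<Rightarrow> nat \<Rightarrow> 'a set" where
  "ideal_power R I n \<equiv> I [^]\<^bsub>ideals_set R\<^esub> n"

definition sharp :: "('a, 'b) ring_scheme \<Rightarrow> 'a set \<Rightarrow> 'a set" where
  "sharp R I =
     Idl\<^bsub>R\<^esub> {x \<in> carrier R. \<exists>n::nat. n \<ge> 1 \<and> x [^]\<^bsub>R\<^esub> n \<in> ideal_power R I n}"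

text \<open>
  Level 0 is \<open>I\<close> itself, so that level 1 is \<^term>\<open>sharp R I\<close>.
\<close>

primrec sharp_iter :: "('a, 'b) ring_scheme \<Rightarrow> 'a set \<Rightarrow> nat \<Rightarrow> 'a set" where
  "sharp_iter R I 0 = I"
| "sharp_iter R I (Suc l) = sharp R (sharp_iter R I l)"

definition boxed_sharp :: "('a, 'b) ring_scheme \<Rightarrow> 'a set \<Rightarrow> 'a set" where
  "boxed_sharp R I = (\<Union>l\<in>{1..}. sharp_iter R I l)"

definition natural_closure :: "('a, 'b) ring_scheme \<Rightarrow> 'a set \<Rightarrow> 'a set" where
  "natural_closure R I =
     {x \<in> carrier R. \<exists>n::nat. n \<ge> 1 \<and> x [^]\<^bsub>R\<^esub> n \<in> boxed_sharp R (ideal_power R I n)}"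


section \<open>The ring\<close>

datatype indet = A | B | C | T

text \<open>
  Monomials are exponent vectors \<^typ>\<open>indet \<Rightarrow>\<^sub>0 nat\<close>; the multiplication of \<^type>\<open>poly_mapping\<close> is
  convolution, so the following type is the polynomial ring in four indeterminates over the field
  with two elements.
\<close>

type_synonym poly4 = "(indet \<Rightarrow>\<^sub>0 nat) \<Rightarrow>\<^sub>0 bit"

definition Var :: "indet \<Rightarrow> poly4" where
  "Var v = Poly_Mapping.single (Poly_Mapping.single v 1) 1"

abbreviation poly4_ring :: "poly4 ring" where
  "poly4_ring \<equiv> ring_of_type_algebra"

definition relators :: "poly4 set" where
  "relators = {Var A ^ 3 - Var C ^ 6, Var B ^ 3 - Var C ^ 6, Var T ^ 2 - Var A - Var B}"

definition relation_ideal :: "poly4 set" where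
  "relation_ideal = Idl\<^bsub>poly4_ring\<^esub> relators"

definition R :: "poly4 set ring" where
  "R = poly4_ring Quot relation_ideal"

definition residue_class :: "poly4 \<Rightarrow> poly4 set" where
  "residue_class p = relation_ideal +>\<^bsub>poly4_ring\<^esub> p"

lemma ideal_relation_ideal: "ideal relation_ideal poly4_ring"
  unfolding relation_ideal_def
  by (rule ring.genideal_ideal[OF ring_from_type_algebra]) (simp add: ring_of_type_algebra_def)

lemma cring_poly4_ring: "cring poly4_ring"
  by (intro cring.intro ring_from_type_algebra comm_monoid.intro comm_monoid_axioms.intro
        ring.is_monoid) (simp add: ring_of_type_algebra_def mult.commute)

lemma cring_R: "cring R"
  unfolding R_def
  by (rule ideal.quotient_is_cring[OF ideal_relation_ideal cring_poly4_ring])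

lemma residue_class_in_R: "residue_class p \<in> carrier R"
  by (auto simp: R_def residue_class_def FactRing_def A_RCOSETS_def' ring_of_type_algebra_def)


section \<open>The grading\<close>

text \<open>
  The relators are homogeneous for these weights, hence \<^term>\<open>R\<close> is graded.
\<close>

primrec indet_degree :: "indet \<Rightarrow> nat" where
  "indet_degree A = 2"
| "indet_degree B = 2"
| "indet_degree C = 1"
| "indet_degree T = 1"

definition monomial_degree :: "(indet \<Rightarrow>\<^sub>0 nat) \<Rightarrow> nat" where
  "monomial_degree m = (\<Sum>v\<in>{A, B, C, T}. Poly_Mapping.lookup m v * indet_degree v)"

definition homogeneous :: "nat \<Rightarrow> poly4 \<Rightarrow> bool" where
  "homogeneous d p \<longleftrightarrow> (\<forall>m\<in>Poly_Mapping.keys p. monomial_degree m = d)"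

lemma homogeneous_Var: "homogeneous (indet_degree v) (Var v)"
  by (cases v) (simp_all add: homogeneous_def monomial_degree_def Var_def lookup_single)

lemma homogeneous_one: "homogeneous 0 1"
  by (simp add: homogeneous_def monomial_degree_def)

lemma homogeneous_diff:
  assumes "homogeneous d p" "homogeneous d q"
  shows "homogeneous d (p - q)"
  using assms keys_diff[of p q] by (auto simp: homogeneous_def)

lemma homogeneous_mult:
  assumes "homogeneous d p" "homogeneous e q"
  shows "homogeneous (d + e) (p * q)"
  unfolding homogeneous_def
proof
  fix m assume "m \<in> Poly_Mapping.keys (p * q)"
  then obtain a b where "a \<in> Poly_Mapping.keys p" "b \<in> Poly_Mapping.keys q" "m = a + b"
    using keys_mult[of p q] by auto
  moreover have "monomial_degree (a + b) = monomial_degree a + monomial_degree b"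
    by (simp add: monomial_degree_def lookup_add algebra_simps)
  ultimately show "monomial_degree m = d + e"
    using assms by (auto simp: homogeneous_def)
qed

lemma homogeneous_power: "homogeneous d p \<Longrightarrow> homogeneous (n * d) (p ^ n)"
  by (induction n) (simp_all add: homogeneous_one homogeneous_mult)

lemma relators_homogeneous:
  "homogeneous 6 (Var A ^ 3 - Var C ^ 6)"
  "homogeneous 6 (Var B ^ 3 - Var C ^ 6)"
  "homogeneous 2 (Var T ^ 2 - Var A - Var B)"
  using homogeneous_power[OF homogeneous_Var[of A], of 3] homogeneous_power[OF homogeneous_Var[of B], of 3]
    homogeneous_power[OF homogeneous_Var[of C], of 6] homogeneous_power[OF homogeneous_Var[of T], of 2]
    homogeneous_Var[of A] homogeneous_Var[of B]
  by (simp_all add: homogeneous_diff)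

end

theory Submission
  imports Defs "HOL-Computational_Algebra.Polynomial" "HOL-Library.Numeral_Type"
begin

text \<open>
  Membership in the natural closure is quick: \<open>a\<^sup>3 = b\<^sup>3 = (c\<^sup>2)\<^sup>3\<close> lies in \<open>(I\<^sup>2)\<^sup>3\<close>, so
  \<open>a\<close> and \<open>b\<close> lie in the sharp closure of \<open>I\<^sup>2\<close>, and so does \<open>t\<^sup>2 = a + b\<close>.

  For the other half, an ideal \<open>J \<supseteq> I\<close> with \<open>t \<notin> J\<close> is needed that is stable under the sharp
  operation, that is, \<open>x\<^sup>n \<in> J\<^sup>n\<close> implies \<open>x \<in> J\<close>. It comes from one homomorphism
  \<open>\<phi>\<close> of \<open>R\<close> to the polynomials in \<open>X\<close> over the group algebra \<open>k = \<int>\<^sub>2[u]/(u\<^sup>3 - 1)\<close>, namely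
  \<open>a \<mapsto> u X\<^sup>2\<close>, \<open>b \<mapsto> u\<^sup>2 X\<^sup>2\<close>, \<open>c \<mapsto> X\<close>, \<open>t \<mapsto> (u + u\<^sup>2) X\<close>. It respects the last relation
  because \<open>u + u\<^sup>2\<close> is idempotent.
  Let \<open>J\<close> consist of the \<open>x\<close> for which \<open>\<phi> x\<close> has constant coefficient \<open>0\<close> and linear
  coefficient in the prime field \<open>{0, 1}\<close>. It contains \<open>c\<close> but not \<open>t\<close>.

  Elements of \<open>J\<^sup>n\<close> have images of order at least \<open>n\<close> whose coefficient of \<open>X\<^sup>n\<close> is again in the
  prime field. Every element of \<open>R\<close> has an image with constant coefficient in \<open>{0, 1}\<close> and
  idempotent linear coefficient \<open>e\<close> (lemma \<open>\<phi>_coeffs\<close>), since the images of \<open>a\<close> and \<open>b\<close>, the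
  only ones with coefficients that are not idempotent, start in degree two. If \<open>x\<^sup>n \<in> J\<^sup>n\<close> with \<open>n \<ge> 1\<close>,
  then the constant coefficient of \<open>\<phi> x\<close> is nilpotent, hence \<open>0\<close>, and the coefficient of
  \<open>X\<^sup>n\<close> in \<open>\<phi> (x\<^sup>n)\<close> is \<open>e\<^sup>n = e\<close>; so \<open>e \<in> {0, 1}\<close> and \<open>x \<in> J\<close> (lemma \<open>prime_leading_root\<close>).
\<close>

section \<open>Substitution into polynomials over the field with two elements\<close>

definition monomial_value :: "(indet \<Rightarrow> 'a::comm_ring_1) \<Rightarrow> (indet \<Rightarrow>\<^sub>0 nat) \<Rightarrow> 'a" where
  "monomial_value f m = (\<Prod>v\<in>{A, B, C, T}. f v ^ Poly_Mapping.lookup m v)"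

text \<open>
  A coefficient in the field with two elements is \<open>1\<close> exactly on the keys, so a polynomial is the
  sum of the monomials in its keys. Substitution is a ring homomorphism when the target has characteristic two.
\<close>
definition substitute :: "(indet \<Rightarrow> 'a::comm_ring_1) \<Rightarrow> poly4 \<Rightarrow> 'a" where
  "substitute f p = (\<Sum>m\<in>Poly_Mapping.keys p. monomial_value f m)"

lemma monomial_value_add:
  "monomial_value f (m + n) = monomial_value f m * monomial_value f n"
  by (simp add: monomial_value_def lookup_add power_add prod.distrib algebra_simps)

lemma monomial_value_single: "monomial_value f (Poly_Mapping.single v n) = f v ^ n"
  by (cases v) (simp_all add: monomial_value_def lookup_single)

lemma substitute_0: "substitute f 0 = 0"
  by (simp add: substitute_def)

lemma substitute_1: "substitute f 1 = 1"
  by (simp add: substitute_def monomial_value_def)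

lemma substitute_single: "substitute f (Poly_Mapping.single m 1) = monomial_value f m"
  by (simp add: substitute_def)

lemma substitute_Var: "substitute f (Var v) = f v"
  by (simp add: Var_def substitute_single monomial_value_single)

lemma substitute_add:
  fixes f :: "indet \<Rightarrow> 'a::comm_ring_1"
  assumes char: "(1::'a) + 1 = 0"
  shows "substitute f (p + q) = substitute f p + substitute f q"
proof -
  define h :: "bit \<Rightarrow> 'a" where "h b = of_bool (b = 1)" for b
  have h: "h (a + b) = h a + h b" for a b
    using char by (cases a; cases b) (simp_all add: h_def)
  define S where "S = Poly_Mapping.keys p \<union> Poly_Mapping.keys q"
  have "finite S" by (simp add: S_def)
  have over_S: "substitute f r = (\<Sum>m\<in>S. h (Poly_Mapping.lookup r m) * monomial_value f m)"
    if "Poly_Mapping.keys r \<subseteq> S" for r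
    unfolding substitute_def
    by (rule sum.mono_neutral_cong_left)
      (use that \<open>finite S\<close> in \<open>auto simp: h_def in_keys_iff\<close>)
  have "Poly_Mapping.keys (p + q) \<subseteq> S"
    unfolding S_def by (rule Poly_Mapping.keys_add)
  then show ?thesis
    by (simp add: over_S[of p] over_S[of q] over_S[of "p + q"] S_def lookup_add h distrib_right
        sum.distrib del: add_bit_eq_xor)
qed

lemma poly4_induct [case_names zero add]:
  assumes "P 0"
    and "\<And>m p. P p \<Longrightarrow> P (Poly_Mapping.single m 1 + p)"
  shows "P (p :: poly4)"
proof (induction p rule: update_induct)
  case const
  show ?case by (rule assms(1))
next
  case (update p m b)
  have "Poly_Mapping.update m b p = Poly_Mapping.single m 1 + p"
    using update(1,2)
    by (intro poly_mapping_eqI)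
      (auto simp: lookup_update lookup_add lookup_single in_keys_iff when_def)
  with assms(2)[OF update(3)] show ?case by simp
qed

lemma substitute_mult:
  fixes f :: "indet \<Rightarrow> 'a::comm_ring_1"
  assumes char: "(1::'a) + 1 = 0"
  shows "substitute f (p * q) = substitute f p * substitute f q"
proof (induction p rule: poly4_induct)
  case zero
  show ?case by (simp add: substitute_0)
next
  case (add m p)
  have "substitute f (Poly_Mapping.single m 1 * q) = monomial_value f m * substitute f q"
    by (induction q rule: poly4_induct)
      (simp_all add: substitute_0 substitute_add[OF char] substitute_single mult_single
        monomial_value_add distrib_left)
  with add show ?case
    by (simp add: substitute_add[OF char] substitute_single distrib_right)
qed

lemma substitute_power:
  fixes f :: "indet \<Rightarrow> 'a::comm_ring_1"
  assumes "(1::'a) + 1 = 0"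
  shows "substitute f (p ^ n) = substitute f p ^ n"
  by (induction n) (simp_all add: substitute_1 substitute_mult[OF assms])

lemma substitute_diff:
  fixes f :: "indet \<Rightarrow> 'a::comm_ring_1"
  assumes "(1::'a) + 1 = 0"
  shows "substitute f (p - q) = substitute f p - substitute f q"
  using substitute_add[OF assms, of f "p - q" q] by simp

section \<open>A homomorphism to polynomials over a group algebra\<close>

text \<open>
  The numeral type \<open>3\<close> is the additive cyclic group of order three, so convolution makes this type
  its group algebra; it splits as the product of the fields with two and with four elements.
\<close>
type_synonym group_algebra = "3 \<Rightarrow>\<^sub>0 bit"

text \<open>The element called \<open>u\<close> above.\<close>
definition cube_root :: group_algebra where
  "cube_root = Poly_Mapping.single 1 1"

lemma group_algebra_char_2: "(x::group_algebra) + x = 0"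
proof (rule poly_mapping_eqI)
  have "b + b = 0" for b :: bit by (cases b) simp_all
  then show "Poly_Mapping.lookup (x + x) k = Poly_Mapping.lookup 0 k" for k
    by (simp only: lookup_add lookup_zero)
qed

lemma poly_char_2: "(1::group_algebra poly) + 1 = 0"
  using group_algebra_char_2[of 1] by (simp add: one_pCons)

lemma cube_root_powers: "cube_root ^ 3 = 1" "cube_root ^ 4 = cube_root"
proof -
  have "Poly_Mapping.single (3::3) (1::bit) = Poly_Mapping.single 0 1"
    "Poly_Mapping.single (4::3) (1::bit) = Poly_Mapping.single 1 1"
    by (rule arg_cong[where f = "\<lambda>i. Poly_Mapping.single i 1"], simp)+
  then show "cube_root ^ 3 = 1" "cube_root ^ 4 = cube_root"
    by (simp_all add: cube_root_def power_numeral_even power_numeral_odd mult_single)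
qed

text \<open>
  Squaring is additive in characteristic two and interchanges \<open>u\<close> and \<open>u\<^sup>2\<close> when \<open>u\<^sup>3 = 1\<close>.
\<close>
lemma cube_root_idempotent: "(cube_root + cube_root\<^sup>2)\<^sup>2 = cube_root + cube_root\<^sup>2"
proof -
  have "(cube_root + cube_root\<^sup>2)\<^sup>2 = cube_root\<^sup>2 + (cube_root ^ 3 + cube_root ^ 3) + cube_root ^ 4"
    by (simp add: algebra_simps power2_eq_square power_numeral_even power_numeral_odd)
  then show ?thesis
    by (simp add: group_algebra_char_2 cube_root_powers(2) add.commute)
qed

lemma cube_root_idempotent_nontrivial:
  "cube_root + cube_root\<^sup>2 \<noteq> 0" "cube_root + cube_root\<^sup>2 \<noteq> 1"
proof -
  have "Poly_Mapping.lookup (cube_root + cube_root\<^sup>2) 1 = 1"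
    by (simp add: cube_root_def power2_eq_square mult_single lookup_add lookup_single)
  then show "cube_root + cube_root\<^sup>2 \<noteq> 0" "cube_root + cube_root\<^sup>2 \<noteq> 1"
    by (auto simp: lookup_one)
qed

primrec point :: "indet \<Rightarrow> group_algebra poly" where
  "point A = monom cube_root 2"
| "point B = monom (cube_root\<^sup>2) 2"
| "point C = monom 1 1"
| "point T = monom (cube_root + cube_root\<^sup>2) 1"

abbreviation \<phi> :: "poly4 \<Rightarrow> group_algebra poly" where
  "\<phi> \<equiv> substitute point"

lemmas \<phi>_add = substitute_add[OF poly_char_2]
  and \<phi>_diff = substitute_diff[OF poly_char_2]
  and \<phi>_mult = substitute_mult[OF poly_char_2]
  and \<phi>_power = substitute_power[OF poly_char_2]

lemma \<phi>_relators:
  assumes "r \<in> relators"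
  shows "\<phi> r = 0"
proof -
  have "(cube_root\<^sup>2) ^ 3 = (cube_root ^ 3) ^ 2"
    by (simp flip: power_mult)
  then have "(cube_root\<^sup>2) ^ 3 = 1"
    by (simp add: cube_root_powers)
  then have "\<phi> (Var A ^ 3 - Var C ^ 6) = 0" "\<phi> (Var B ^ 3 - Var C ^ 6) = 0"
    by (simp_all add: \<phi>_diff \<phi>_power substitute_Var monom_power cube_root_powers(1))
  moreover have "\<phi> (Var T ^ 2 - Var A - Var B) =
      monom ((cube_root + cube_root\<^sup>2)\<^sup>2) 2 - (monom cube_root 2 + monom (cube_root\<^sup>2) 2)"
    unfolding \<phi>_diff \<phi>_power substitute_Var point.simps monom_power by simp
  then have "\<phi> (Var T ^ 2 - Var A - Var B) = 0"
    unfolding cube_root_idempotent add_monom by simp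
  ultimately show ?thesis
    using assms by (auto simp only: relators_def insert_iff empty_iff)
qed

lemma \<phi>_relation_ideal:
  assumes "p \<in> relation_ideal"
  shows "\<phi> p = 0"
proof -
  interpret P: cring poly4_ring by (rule cring_poly4_ring)
  have "ideal {p. \<phi> p = 0} poly4_ring"
  proof (rule idealI)
    show "ring poly4_ring" ..
    show "subgroup {p. \<phi> p = 0} (add_monoid poly4_ring)"
    proof (rule P.add.subgroupI)
      fix a assume a: "a \<in> {p. \<phi> p = 0}"
      have "\<ominus>\<^bsub>poly4_ring\<^esub> a = - a"
        by (rule P.minus_equality) (auto simp: ring_of_type_algebra_def)
      moreover have "\<phi> (- a) = - \<phi> a"
        using \<phi>_diff[of point 0 a] by (simp add: substitute_0)
      ultimately show "\<ominus>\<^bsub>poly4_ring\<^esub> a \<in> {p. \<phi> p = 0}"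
        using a by simp
    qed (auto simp: ring_of_type_algebra_def \<phi>_add intro: substitute_0)
  qed (auto simp: ring_of_type_algebra_def \<phi>_mult)
  then have "relation_ideal \<subseteq> {p. \<phi> p = 0}"
    unfolding relation_ideal_def by (rule P.genideal_minimal) (auto simp: \<phi>_relators)
  with assms show ?thesis by auto
qed

section \<open>Residue classes\<close>

lemma residue_class_hom: "residue_class \<in> ring_hom poly4_ring R"
proof -
  have "residue_class = (+>\<^bsub>poly4_ring\<^esub>) relation_ideal"
    by (auto simp: residue_class_def)
  then show ?thesis
    using ideal.rcos_ring_hom[OF ideal_relation_ideal] by (simp add: R_def)
qed

lemma residue_class_eqI:
  assumes "p - q \<in> relation_ideal"
  shows "residue_class p = residue_class q"
proof -
  interpret rel: ideal relation_ideal poly4_ring by (rule ideal_relation_ideal)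
  have "p = (p - q) \<oplus>\<^bsub>poly4_ring\<^esub> q"
    by (simp add: ring_of_type_algebra_def)
  with assms have "p \<in> relation_ideal +>\<^bsub>poly4_ring\<^esub> q"
    unfolding a_r_coset_def' by blast
  then show ?thesis
    using rel.a_repr_independence'[of p q]
    by (simp add: residue_class_def ring_of_type_algebra_def)
qed

text \<open>
  So \<open>\<phi>\<close> is defined on \<open>R\<close>, and the conditions below on elements of \<open>R\<close> may be stated through any
  representative.
\<close>
lemma \<phi>_cong:
  assumes "residue_class p = residue_class q"
  shows "\<phi> p = \<phi> q"
proof -
  interpret rel: ideal relation_ideal poly4_ring by (rule ideal_relation_ideal)
  have "p \<in> relation_ideal +>\<^bsub>poly4_ring\<^esub> q"
    using assms rel.a_rcos_self[of p] by (simp add: residue_class_def ring_of_type_algebra_def)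
  then obtain r where "r \<in> relation_ideal" "p = r + q"
    by (auto simp: a_r_coset_def' ring_of_type_algebra_def)
  then show ?thesis by (simp add: \<phi>_add \<phi>_relation_ideal)
qed

lemma carrier_RE:
  assumes "x \<in> carrier R"
  obtains p where "x = residue_class p"
  using assms by (auto simp: R_def residue_class_def FactRing_def A_RCOSETS_def')

lemma
  shows residue_class_mult: "residue_class p \<otimes>\<^bsub>R\<^esub> residue_class q = residue_class (p * q)"
    and residue_class_add: "residue_class p \<oplus>\<^bsub>R\<^esub> residue_class q = residue_class (p + q)"
    and residue_class_one: "\<one>\<^bsub>R\<^esub> = residue_class 1"
  using ring_hom_mult[OF residue_class_hom, of p q] ring_hom_add[OF residue_class_hom, of p q]
    ring_hom_one[OF residue_class_hom]
  by (simp_all add: ring_of_type_algebra_def)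

lemma residue_class_power: "residue_class p [^]\<^bsub>R\<^esub> (n::nat) = residue_class (p ^ n)"
  by (induction n) (simp_all add: nat_pow_def residue_class_one residue_class_mult mult.commute)

section \<open>Elements with leading coefficient in the prime field\<close>

text \<open>
  The polynomials with these two properties form a ring: the linear coefficient of \<open>g h\<close> is
  \<open>g\<^sub>0 h\<^sub>1 + h\<^sub>0 g\<^sub>1\<close> with \<open>g\<^sub>0\<close> and \<open>h\<^sub>0\<close> equal to \<open>0\<close> or \<open>1\<close>, and sums of idempotents are idempotent in
  characteristic two. The values of the four indeterminates belong to it.
\<close>
lemma \<phi>_coeffs:
  "coeff (\<phi> p) 0 \<in> {0, 1} \<and> (coeff (\<phi> p) 1)\<^sup>2 = coeff (\<phi> p) 1"
proof -
  define Q where "Q = {g :: group_algebra poly. coeff g 0 \<in> {0, 1} \<and> (coeff g 1)\<^sup>2 = coeff g 1}"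
  have add: "g + h \<in> Q" if "g \<in> Q" "h \<in> Q" for g h
  proof -
    have "(x + y)\<^sup>2 = x\<^sup>2 + y\<^sup>2" for x y :: group_algebra
      using group_algebra_char_2[of "x * y"] by (simp add: power2_eq_square algebra_simps)
    with that show ?thesis by (auto simp: Q_def group_algebra_char_2)
  qed
  have mult: "g * h \<in> Q" if g: "g \<in> Q" and h: "h \<in> Q" for g h
  proof -
    have "[:coeff g 0:] * h \<in> Q" "[:coeff h 0:] * g \<in> Q"
      using g h by (auto simp: Q_def)
    from add[OF this] have *: "(coeff g 0 * coeff h 1 + coeff h 0 * coeff g 1)\<^sup>2 =
        coeff g 0 * coeff h 1 + coeff h 0 * coeff g 1"
      by (simp add: Q_def)
    have "coeff (g * h) 1 = coeff g 0 * coeff h 1 + coeff h 0 * coeff g 1"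
      by (simp add: coeff_mult algebra_simps)
    moreover have "coeff (g * h) 0 \<in> {0, 1}"
      using g h by (auto simp: Q_def coeff_mult)
    ultimately show ?thesis using * by (simp add: Q_def)
  qed
  have one: "1 \<in> Q" by (simp add: Q_def)
  have point: "point v \<in> Q" for v
    by (cases v) (simp_all add: Q_def cube_root_idempotent)
  have power: "g ^ n \<in> Q" if "g \<in> Q" for g n
    using that by (induction n) (simp_all add: one mult)
  have "monomial_value point m \<in> Q" for m
    by (simp add: monomial_value_def mult power point del: point.simps)
  then have "(\<Sum>m\<in>M. monomial_value point m) \<in> Q" for M
    by (induction M rule: infinite_finite_induct) (simp_all add: add, simp_all add: Q_def)
  then have "\<phi> p \<in> Q"
    unfolding substitute_def .
  then show ?thesis by (simp add: Q_def)
qed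

text \<open>
  Level \<open>1\<close> is the ideal \<open>J\<close> that separates \<open>t\<close> from the boxed sharp closure of \<open>I\<close>; level \<open>n\<close> is
  an upper bound for \<open>J\<^sup>n\<close> that is easier to handle than the power.
\<close>
definition prime_leading :: "nat \<Rightarrow> poly4 set set" where
  "prime_leading n = {residue_class p | p. (\<forall>k<n. coeff (\<phi> p) k = 0) \<and> coeff (\<phi> p) n \<in> {0, 1}}"

lemma residue_class_prime_leading_iff:
  "residue_class p \<in> prime_leading n \<longleftrightarrow> (\<forall>k<n. coeff (\<phi> p) k = 0) \<and> coeff (\<phi> p) n \<in> {0, 1}"
proof
  assume "residue_class p \<in> prime_leading n"
  then obtain q where "residue_class p = residue_class q"
    and q: "\<forall>k<n. coeff (\<phi> q) k = 0" "coeff (\<phi> q) n \<in> {0, 1}"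
    unfolding prime_leading_def by blast
  then have "\<phi> p = \<phi> q" by (intro \<phi>_cong)
  with q show "(\<forall>k<n. coeff (\<phi> p) k = 0) \<and> coeff (\<phi> p) n \<in> {0, 1}" by simp
qed (auto simp: prime_leading_def)

lemma prime_leadingE:
  assumes "x \<in> prime_leading n"
  obtains p where "x = residue_class p" "\<forall>k<n. coeff (\<phi> p) k = 0" "coeff (\<phi> p) n \<in> {0, 1}"
  using assms unfolding prime_leading_def by blast

lemma prime_leading_0: "prime_leading 0 = carrier R"
proof
  show "prime_leading 0 \<subseteq> carrier R" by (auto simp: prime_leading_def residue_class_in_R)
  show "carrier R \<subseteq> prime_leading 0"
  proof
    fix x assume "x \<in> carrier R"
    then obtain p where "x = residue_class p" by (rule carrier_RE)
    then show "x \<in> prime_leading 0" using \<phi>_coeffs[of p] by (simp add: residue_class_prime_leading_iff)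
  qed
qed

lemma prime_leading_add:
  assumes "x \<in> prime_leading n" "y \<in> prime_leading n"
  shows "x \<oplus>\<^bsub>R\<^esub> y \<in> prime_leading n"
proof -
  obtain p where x: "x = residue_class p"
    and p: "\<forall>k<n. coeff (\<phi> p) k = 0" "coeff (\<phi> p) n \<in> {0, 1}"
    using assms(1) by (rule prime_leadingE)
  obtain q where y: "y = residue_class q"
    and q: "\<forall>k<n. coeff (\<phi> q) k = 0" "coeff (\<phi> q) n \<in> {0, 1}"
    using assms(2) by (rule prime_leadingE)
  have "coeff (\<phi> (p + q)) n \<in> {0, 1}"
    using p(2) q(2) by (auto simp: \<phi>_add group_algebra_char_2)
  moreover have "\<forall>k<n. coeff (\<phi> (p + q)) k = 0"
    using p(1) q(1) by (simp add: \<phi>_add)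
  ultimately show ?thesis
    unfolding x y residue_class_add residue_class_prime_leading_iff by blast
qed

lemma coeff_mult_low:
  fixes g h :: "'a::comm_semiring_1 poly"
  assumes "\<forall>k<m. coeff g k = 0" "\<forall>k<n. coeff h k = 0"
  shows "\<forall>k<m + n. coeff (g * h) k = 0" "coeff (g * h) (m + n) = coeff g m * coeff h n"
proof -
  obtain g' h' where g': "g = monom 1 m * g'" and h': "h = monom 1 n * h'"
    using assms monom_1_dvd_iff' unfolding dvd_def by metis
  have "g * h = monom 1 (m + n) * (g' * h')"
    using mult_monom[of "1::'a" m 1 n] by (metis g' h' mult.assoc mult.left_commute mult_1)
  then show "\<forall>k<m + n. coeff (g * h) k = 0" "coeff (g * h) (m + n) = coeff g m * coeff h n"
    by (simp_all add: coeff_monom_mult coeff_mult_0) (simp_all add: g' h' coeff_monom_mult)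
qed

lemma prime_leading_mult:
  assumes "x \<in> prime_leading m" "y \<in> prime_leading n"
  shows "x \<otimes>\<^bsub>R\<^esub> y \<in> prime_leading (m + n)"
proof -
  obtain p where "x = residue_class p" and p: "\<forall>k<m. coeff (\<phi> p) k = 0" "coeff (\<phi> p) m \<in> {0, 1}"
    using assms(1) by (rule prime_leadingE)
  moreover obtain q where "y = residue_class q"
    and q: "\<forall>k<n. coeff (\<phi> q) k = 0" "coeff (\<phi> q) n \<in> {0, 1}"
    using assms(2) by (rule prime_leadingE)
  moreover have "coeff (\<phi> p) m * coeff (\<phi> q) n \<in> {0, 1}"
    using p(2) q(2) by auto
  ultimately show ?thesis
    using coeff_mult_low[OF p(1) q(1)]
    by (simp add: residue_class_mult residue_class_prime_leading_iff \<phi>_mult)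
qed

text \<open>
  Closure under multiplication by \<open>R\<close> rests on all constant coefficients of images lying in the
  prime field, that is, on level \<open>0\<close> being the whole ring.
\<close>
lemma ideal_prime_leading: "ideal (prime_leading n) R"
proof -
  interpret R: cring R by (rule cring_R)
  have l_mult: "x \<otimes>\<^bsub>R\<^esub> a \<in> prime_leading n" if "a \<in> prime_leading n" "x \<in> carrier R" for a x
    using prime_leading_mult[of x 0 a n] that by (simp add: prime_leading_0)
  show ?thesis
  proof (rule idealI)
    show "ring R" ..
    show "subgroup (prime_leading n) (add_monoid R)"
    proof (rule R.add.subgroupI)
      show "prime_leading n \<subseteq> carrier R"
        by (auto simp: prime_leading_def residue_class_in_R)
      show "prime_leading n \<noteq> {}"
        using residue_class_prime_leading_iff[of 0 n] by (auto simp: substitute_0)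
      show "\<ominus>\<^bsub>R\<^esub> a \<in> prime_leading n" if "a \<in> prime_leading n" for a
      proof -
        from that have "\<ominus>\<^bsub>R\<^esub> \<one>\<^bsub>R\<^esub> \<otimes>\<^bsub>R\<^esub> a \<in> prime_leading n"
          by (intro l_mult) auto
        moreover have "a \<in> carrier R"
          using that by (auto simp: prime_leading_def residue_class_in_R)
        ultimately show ?thesis by (simp add: R.l_minus)
      qed
    qed (auto intro: prime_leading_add)
    show "x \<otimes>\<^bsub>R\<^esub> a \<in> prime_leading n" if "a \<in> prime_leading n" "x \<in> carrier R" for a x
      by (rule l_mult) fact+
    show "a \<otimes>\<^bsub>R\<^esub> x \<in> prime_leading n" if "a \<in> prime_leading n" "x \<in> carrier R" for a x
      using prime_leading_mult[of a n x 0] that by (simp add: prime_leading_0)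
  qed
qed

text \<open>
  This is what makes level \<open>1\<close> stable under the sharp operation. Idempotence of the linear
  coefficient is essential: a cube root of unity would be lost in its cube.
\<close>
lemma prime_leading_root:
  assumes x: "x \<in> carrier R" and n: "n \<ge> 1" and xn: "x [^]\<^bsub>R\<^esub> n \<in> prime_leading n"
  shows "x \<in> prime_leading 1"
proof -
  obtain p where p: "x = residue_class p" using x by (rule carrier_RE)
  define g where "g = \<phi> p"
  have low: "\<forall>k<n. coeff (g ^ n) k = 0" and top: "coeff (g ^ n) n \<in> {0, 1}"
    using xn by (auto simp: p residue_class_power residue_class_prime_leading_iff \<phi>_power g_def)
  have g0: "coeff g 0 \<in> {0, 1}" and g1: "(coeff g 1)\<^sup>2 = coeff g 1"
    using \<phi>_coeffs[of p] by (auto simp: g_def)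
  have "coeff g 0 ^ n = 0"
    using low n by (simp flip: coeff_0_power)
  with g0 have 0: "coeff g 0 = 0" by auto
  have "(\<forall>k<m. coeff (g ^ m) k = 0) \<and> coeff (g ^ m) m = coeff g 1 ^ m" for m
    using 0 coeff_mult_low[of 1 g] by (induction m) auto
  then have "coeff (g ^ n) n = coeff g 1 ^ n" by blast
  moreover have "coeff g 1 ^ Suc m = coeff g 1" for m
    using g1 by (induction m) (simp_all add: power2_eq_square)
  then have "coeff g 1 ^ n = coeff g 1"
    using n by (metis Suc_diff_1 less_eq_Suc_le One_nat_def)
  ultimately have "coeff g 1 \<in> {0, 1}"
    using top by metis
  with 0 show ?thesis
    unfolding p residue_class_prime_leading_iff g_def by simp
qed

section \<open>Ideal powers and closures\<close>

lemma ideal_power_0: "ideal_power S J 0 = carrier S"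
  and ideal_power_Suc: "ideal_power S J (Suc n) = ideal_prod S (ideal_power S J n) J"
  by (simp_all add: nat_pow_def ideals_set_def)

lemma power_in_ideal_power:
  assumes "ring S" "x \<in> carrier S" "x \<in> J"
  shows "x [^]\<^bsub>S\<^esub> (n::nat) \<in> ideal_power S J n"
proof -
  interpret ring S by fact
  show ?thesis
  proof (induction n)
    case 0
    show ?case unfolding ideal_power_0 nat_pow_0 by (rule one_closed)
  next
    case (Suc n)
    then show ?case
      unfolding ideal_power_Suc nat_pow_Suc by (rule ideal_prod.prod) (rule assms(3))
  qed
qed

lemma ideal_power_subset_prime_leading:
  assumes "J \<subseteq> prime_leading 1"
  shows "ideal_power R J n \<subseteq> prime_leading n"
proof (induction n)
  case 0
  show ?case unfolding ideal_power_0 prime_leading_0 ..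
next
  case (Suc n)
  have "x \<in> prime_leading (Suc n)" if "x \<in> ideal_prod R (ideal_power R J n) J" for x
    using that
  proof induction
    case (prod i j)
    then show ?case using prime_leading_mult[of i n j 1] Suc assms by auto
  qed (rule prime_leading_add)
  then show ?case unfolding ideal_power_Suc by blast
qed

lemma sharp_subset_prime_leading:
  assumes "J \<subseteq> prime_leading 1"
  shows "sharp R J \<subseteq> prime_leading 1"
proof -
  interpret R: cring R by (rule cring_R)
  have "{x \<in> carrier R. \<exists>n::nat. n \<ge> 1 \<and> x [^]\<^bsub>R\<^esub> n \<in> ideal_power R J n} \<subseteq> prime_leading 1"
    using prime_leading_root ideal_power_subset_prime_leading[OF assms] by blast
  then show ?thesis
    unfolding sharp_def by (intro R.genideal_minimal ideal_prime_leading)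
qed

lemma boxed_sharp_subset_prime_leading:
  assumes "J \<subseteq> prime_leading 1"
  shows "boxed_sharp R J \<subseteq> prime_leading 1"
proof -
  have "sharp_iter R J l \<subseteq> prime_leading 1" for l
    by (induction l) (simp_all only: sharp_iter.simps assms sharp_subset_prime_leading)
  then show ?thesis by (auto simp: boxed_sharp_def)
qed

lemma sharp_subset_boxed_sharp: "sharp S J \<subseteq> boxed_sharp S J"
proof -
  have "sharp_iter S J 1 \<subseteq> boxed_sharp S J"
    unfolding boxed_sharp_def by (rule UN_upper) simp
  then show ?thesis by simp
qed

lemma sharpI:
  assumes "ring S" "x \<in> carrier S" "n \<ge> 1" "x [^]\<^bsub>S\<^esub> (n::nat) \<in> ideal_power S J n"
  shows "x \<in> sharp S J"
proof -
  interpret ring S by fact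
  have "{x \<in> carrier S. \<exists>n::nat. n \<ge> 1 \<and> x [^]\<^bsub>S\<^esub> n \<in> ideal_power S J n} \<subseteq> sharp S J"
    unfolding sharp_def by (rule genideal_self) blast
  with assms(2-4) show ?thesis by blast
qed

theorem mainTheorem5:
  fixes c t :: "poly4 set" and I :: "poly4 set set"
  assumes "c = residue_class (Var C)"
    and "t = residue_class (Var T)"
    and "I = Idl\<^bsub>R\<^esub> {c}"
  shows "t \<in> natural_closure R I - boxed_sharp R I \<and> boxed_sharp R I \<noteq> natural_closure R I"
proof -
  interpret R: cring R by (rule cring_R)
  interpret P: cring poly4_ring by (rule cring_poly4_ring)
  have "c \<in> prime_leading 1"
    by (simp add: assms(1) residue_class_prime_leading_iff substitute_Var)
  then have "I \<subseteq> prime_leading 1"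
    unfolding assms(3) by (intro R.genideal_minimal ideal_prime_leading) simp
  then have "boxed_sharp R I \<subseteq> prime_leading 1"
    by (rule boxed_sharp_subset_prime_leading)
  moreover have "t \<notin> prime_leading 1"
    using cube_root_idempotent_nontrivial
    by (simp add: assms(2) residue_class_prime_leading_iff substitute_Var)
  ultimately have not_boxed: "t \<notin> boxed_sharp R I" by blast

  have relator_zero: "residue_class p = residue_class q" if "p - q \<in> relators" for p q
  proof (rule residue_class_eqI)
    have "relators \<subseteq> relation_ideal"
      unfolding relation_ideal_def
      by (rule P.genideal_self) (simp add: ring_of_type_algebra_def)
    with that show "p - q \<in> relation_ideal" by blast
  qed
  have c: "c \<in> carrier R" "c \<in> I"
    using R.genideal_self[of "{c}"] by (auto simp: assms(1,3) residue_class_in_R)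
  have c6: "residue_class (Var C ^ 6) \<in> ideal_power R (ideal_power R I 2) 3"
  proof -
    have "c [^]\<^bsub>R\<^esub> (2::nat) \<in> ideal_power R I 2"
      using c by (intro power_in_ideal_power) (auto intro: R.ring_axioms)
    then have "(c [^]\<^bsub>R\<^esub> (2::nat)) [^]\<^bsub>R\<^esub> (3::nat) \<in> ideal_power R (ideal_power R I 2) 3"
      using c by (intro power_in_ideal_power) (auto intro: R.ring_axioms)
    then show ?thesis
      by (simp add: assms(1) residue_class_power flip: power_mult)
  qed
  have sharp: "residue_class (Var v) \<in> sharp R (ideal_power R I 2)" if "v \<in> {A, B}" for v
  proof (rule sharpI)
    have "residue_class (Var v ^ 3) = residue_class (Var C ^ 6)"
      using that by (intro relator_zero) (auto simp: relators_def)
    then show "residue_class (Var v) [^]\<^bsub>R\<^esub> (3::nat) \<in> ideal_power R (ideal_power R I 2) 3"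
      using c6 by (simp add: residue_class_power)
  qed (auto intro: R.ring_axioms residue_class_in_R)
  have "t [^]\<^bsub>R\<^esub> (2::nat) = residue_class (Var A + Var B)"
    unfolding assms(2) residue_class_power
    by (rule relator_zero) (simp add: relators_def algebra_simps)
  also have "\<dots> = residue_class (Var A) \<oplus>\<^bsub>R\<^esub> residue_class (Var B)"
    by (simp add: residue_class_add)
  also have "\<dots> \<in> sharp R (ideal_power R I 2)"
  proof -
    have "ideal (sharp R (ideal_power R I 2)) R"
      unfolding sharp_def by (rule R.genideal_ideal) auto
    then show ?thesis
      using sharp by (intro additive_subgroup.a_closed[OF ideal.axioms(1)]) auto
  qed
  finally have "t [^]\<^bsub>R\<^esub> (2::nat) \<in> boxed_sharp R (ideal_power R I 2)"
    by (rule subsetD[OF sharp_subset_boxed_sharp])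
  moreover have "t \<in> carrier R"
    unfolding assms(2) by (rule residue_class_in_R)
  ultimately have "t \<in> natural_closure R I"
    unfolding natural_closure_def using one_le_numeral by blast
  with not_boxed show ?thesis by blast
qed

end
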